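(* Let $\mathbb{F}=\mathbb{F}_q$ be a finite field with $q$ elements, let $V$ be an $n$-dimensional vector space over $\mathbb{F}$ with a fixed basis, let $G$ be a subgroup of $\mathrm{GL}(V)$, and let $W\subset V$ be a nonempty $G$-invariant subset. Let $\kappa$ be the number of $G$-orbits on $W$, let $W=U_1\sqcup\cdots\sqcup U_\kappa$ be the decomposition of $W$ into $G$-orbits, and put $\gamma=\gamma(q,\kappa)=\lceil \log_q(\kappa)\rceil$. Let $f_1,\ldots,f_\kappa\in\mathcal{O}(W)^G$ be the functions defined in the context, so that $f_j(v)=1$ if $v\in U_j$ and $f_j(v)=0$ for $v\in W\setminus U_j$. Then: 1. Every separating set for $\mathcal{O}(W)^G$ contains at least $\gamma(q,\kappa)$ elements. 2. Let $(\alpha_{ij})\in\mathbb{F}^{\gamma\times\kappa}$ be a matrix whose columns are pairwise different and define $$h_i=\alpha_{i1}f_1+\cdots+\alpha_{i\kappa}f_\kappa\qquad(1\le i\le\gamma).$$ Then $\{h_1,\ldots,h_\gamma\}$ is a minimal separating set for $\mathcal{O}(W)^G$ consisting of (non-homogeneous, i.e. not necessarily homogeneous) elements of degree less than or equal to $n(q-1)$.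
   Context: Using the fixed basis, write $v=(v_1,\ldots,v_n)$ for $v\in V$. The algebra $\mathcal{O}(W)$ of polynomial functions on $W$ is the $\mathbb{F}$-algebra of functions $W\to\mathbb{F}$ generated by the coordinate functions $y_1,\ldots,y_n$, $y_i(w)=w_i$. The algebra of invariant polynomial functions is $\mathcal{O}(W)^G=\{f\in\mathcal{O}(W)\mid f(g\cdot w)=f(w)\text{ for all }g\in G, w\in W\}$. The degree of $f\in\mathcal{O}(W)$ is the minimal degree of a polynomial $h\in\mathbb{F}[x_1,\ldots,x_n]$ with $f(w)=h(w_1,\ldots,w_n)$ for all $w\in W$. Elements $u,v\in W$ are separated by a subset $S\subset\mathcal{O}(W)^G$ if there is $f\in S$ with $f(u)\ne f(v)$; they are separated if they are separated by $\mathcal{O}(W)^G$. A subset $S\subset\mathcal{O}(W)^G$ is separating if any $u,v\in W$ that are separated are separated by $S$. A separating set is minimal if it is minimal with respect to inclusion. For $w=(w_1,\ldots,w_n)\in W$ put $$f_w=(-1)^n\prod_{\alpha\in\mathbb{F}\setminus\{w_1\}}(y_1-\alpha)\cdots\prod_{\alpha\in\mathbb{F}\setminus\{w_n\}}(y_n-\alpha)\in\mathcal{O}(W),$$ which takes the value $1$ at $w$ and $0$ at all other points of $W$. For $1\le j\le\kappa$ put $f_j=\sum_{u\in U_j}f_u$. Since $q^{\gamma-1}<\kappa\le q^\gamma$, there exist $\kappa$ pairwise different vectors in $\mathbb{F}^\gamma$. *)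

theory Defs
  imports Complex_Main "HOL-Algebra.Group_Action" "HOL-Library.Poly_Mapping"
begin

text \<open>
  The vector space is a whole type with an explicit scalar multiplication, and the basis is a
  family b 1, ..., b n.  Functions on a subset W are represented extensionally (undefined
  outside W), so that two functions on W are equal iff they agree on W.  In all definitions
  below, y i is the i-th coordinate function; only the indices 1, ..., n are used.
\<close>

definition coord ::
  "('a::field \<Rightarrow> 'v::ab_group_add \<Rightarrow> 'v) \<Rightarrow> nat \<Rightarrow> (nat \<Rightarrow> 'v) \<Rightarrow> nat \<Rightarrow> 'v \<Rightarrow> 'a"
  where "coord scale n b i v = module.representation scale (b ` {1..n}) v (b i)"

definition GL :: "('a::field \<Rightarrow> 'v::ab_group_add \<Rightarrow> 'v) \<Rightarrow> ('v \<Rightarrow> 'v) monoid"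
  where "GL scale =
    \<lparr>carrier = {g. Vector_Spaces.linear scale scale g \<and> bij g}, mult = (\<circ>), one = id\<rparr>"


text \<open>The algebra generated by the coordinate functions on W; it is unital, so \<^emph>\<open>const\<close>
  covers both the unit and the scalar multiplication.\<close>

inductive_set poly_functions :: "'v set \<Rightarrow> nat \<Rightarrow> (nat \<Rightarrow> 'v \<Rightarrow> 'a::field) \<Rightarrow> ('v \<Rightarrow> 'a) set"
  for W :: "'v set" and n :: nat and y :: "nat \<Rightarrow> 'v \<Rightarrow> 'a"
  where
    const: "(\<lambda>w\<in>W. c) \<in> poly_functions W n y"
  | coord: "i \<in> {1..n} \<Longrightarrow> (\<lambda>w\<in>W. y i w) \<in> poly_functions W n y"
  | add: "f \<in> poly_functions W n y \<Longrightarrow> g \<in> poly_functions W n y \<Longrightarrow>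
      (\<lambda>w\<in>W. f w + g w) \<in> poly_functions W n y"
  | mult: "f \<in> poly_functions W n y \<Longrightarrow> g \<in> poly_functions W n y \<Longrightarrow>
      (\<lambda>w\<in>W. f w * g w) \<in> poly_functions W n y"

definition invariant_poly_functions ::
  "('v \<Rightarrow> 'v) set \<Rightarrow> 'v set \<Rightarrow> nat \<Rightarrow> (nat \<Rightarrow> 'v \<Rightarrow> 'a::field) \<Rightarrow> ('v \<Rightarrow> 'a) set"
  where "invariant_poly_functions G W n y =
    {f \<in> poly_functions W n y. \<forall>g\<in>G. \<forall>w\<in>W. f (g w) = f w}"


text \<open>Multivariate polynomials over 'a: finitely supported maps from monomials (exponent
  vectors, indexed by the variables) to coefficients.\<close>

type_synonym 'a mvpoly = "(nat \<Rightarrow>\<^sub>0 nat) \<Rightarrow>\<^sub>0 'a"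

definition mv_polynomials :: "nat \<Rightarrow> ('a::zero) mvpoly set"
  where "mv_polynomials n = {h. \<forall>m\<in>Poly_Mapping.keys h. Poly_Mapping.keys m \<subseteq> {1..n}}"

definition mv_eval :: "('a::field) mvpoly \<Rightarrow> (nat \<Rightarrow> 'a) \<Rightarrow> 'a"
  where "mv_eval h x =
    (\<Sum>m\<in>Poly_Mapping.keys h.
       Poly_Mapping.lookup h m * (\<Prod>i\<in>Poly_Mapping.keys m. x i ^ Poly_Mapping.lookup m i))"

text \<open>The zero polynomial gets total degree 0.\<close>

definition total_degree :: "('a::zero) mvpoly \<Rightarrow> nat"
  where "total_degree h = Max (insert 0
    ((\<lambda>m. \<Sum>i\<in>Poly_Mapping.keys m. Poly_Mapping.lookup m i) ` Poly_Mapping.keys h))"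

text \<open>Only meaningful for elements of \<^const>\<open>poly_functions\<close>, where a polynomial
  inducing f exists.\<close>

definition fun_degree :: "'v set \<Rightarrow> nat \<Rightarrow> (nat \<Rightarrow> 'v \<Rightarrow> 'a::field) \<Rightarrow> ('v \<Rightarrow> 'a) \<Rightarrow> nat"
  where "fun_degree W n y f =
    (LEAST d. \<exists>h \<in> mv_polynomials n.
       (\<forall>w\<in>W. f w = mv_eval h (\<lambda>i. y i w)) \<and> total_degree h = d)"


definition separated_by :: "('v \<Rightarrow> 'a) set \<Rightarrow> 'v \<Rightarrow> 'v \<Rightarrow> bool"
  where "separated_by S u v \<longleftrightarrow> (\<exists>f\<in>S. f u \<noteq> f v)"

definition separating_set :: "('v \<Rightarrow> 'a) set \<Rightarrow> 'v set \<Rightarrow> ('v \<Rightarrow> 'a) set \<Rightarrow> bool"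
  where "separating_set A W S \<longleftrightarrow>
    S \<subseteq> A \<and> (\<forall>u\<in>W. \<forall>v\<in>W. separated_by A u v \<longrightarrow> separated_by S u v)"

definition minimal_separating_set :: "('v \<Rightarrow> 'a) set \<Rightarrow> 'v set \<Rightarrow> ('v \<Rightarrow> 'a) set \<Rightarrow> bool"
  where "minimal_separating_set A W S \<longleftrightarrow>
    separating_set A W S \<and> (\<forall>T. T \<subset> S \<longrightarrow> \<not> separating_set A W T)"


definition point_fun ::
  "'v set \<Rightarrow> nat \<Rightarrow> (nat \<Rightarrow> 'v \<Rightarrow> 'a::{field,finite}) \<Rightarrow> 'v \<Rightarrow> 'v \<Rightarrow> 'a"
  where "point_fun W n y w =
    (\<lambda>v\<in>W. (- 1) ^ n * (\<Prod>i = 1..n. \<Prod>\<alpha> \<in> UNIV - {y i w}. y i v - \<alpha>))"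

definition orbit_fun ::
  "'v set \<Rightarrow> nat \<Rightarrow> (nat \<Rightarrow> 'v \<Rightarrow> 'a::{field,finite}) \<Rightarrow> 'v set \<Rightarrow> 'v \<Rightarrow> 'a"
  where "orbit_fun W n y U = (\<lambda>v\<in>W. \<Sum>u\<in>U. point_fun W n y u v)"

definition gamma :: "nat \<Rightarrow> nat \<Rightarrow> nat"
  where "gamma q k = nat \<lceil>log (real q) (real k)\<rceil>"

end

theory Submission
  imports Defs "HOL-Computational_Algebra.Polynomial"
begin

text \<open>
  The invariant functions are constant on orbits, and the indicator functions of the orbits
  are among them, so two points are separated exactly if they lie in different orbits.  A
  separating set S therefore sends orbits injectively to vectors of length |S| over the field,
  whence \<open>\<kappa> \<le> q ^ |S|\<close>.  The functions \<open>h\<^sub>i\<close> send the j-th orbit to the j-th column of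
  the matrix, so they separate, and by the bound they are minimal since there are at most
  \<open>\<gamma>\<close> of them.
\<close>

section \<open>Finite fields\<close>

text \<open>Evaluate \<open>X\<^sup>q\<^sup>-\<^sup>1 - 1 = \<Prod>\<alpha>\<noteq>0. (X - \<alpha>)\<close> at 0 and translate by x.\<close>

lemma prod_diff_other_elements:
  fixes x :: "'a::{field,finite}"
  shows "(\<Prod>\<alpha>\<in>UNIV - {x}. x - \<alpha>) = -1"
proof -
  define q where "q = card (UNIV :: 'a set)"
  \<comment> \<open>The exponent \<open>q - 1\<close> is positive because 0 and 1 differ. Hence the
    constant term of \<open>P\<close> is separate from its leading term, and \<open>P\<close> takes
    the value -1 at 0.\<close>
  have "card {0, 1::'a} \<le> q"
    unfolding q_def by (rule card_mono) auto
  then have q: "q \<ge> 2" by simp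
  have card: "card (UNIV - {0::'a}) = q - 1"
    by (simp add: q_def card_Diff_singleton)
  define P :: "'a poly" where "P = monom 1 (q - 1) - 1"
  define R :: "'a poly" where "R = (\<Prod>\<alpha>\<in>UNIV - {0}. [:-\<alpha>, 1:])"
  have degR: "degree R = q - 1"
    unfolding R_def by (subst degree_prod_sum_eq) (auto simp: card)
  have "P = R"
  \<comment> \<open>With equal coefficients at \<open>q - 1\<close>, the difference has degree below
    \<open>q - 1\<close> or is zero, yet it vanishes at all \<open>q - 1\<close> nonzero
    elements.\<close>
  proof (rule poly_eqI_degree_lead_coeff[where n = "q - 1" and A = "UNIV - {0}"])
    have "lead_coeff R = 1"
      unfolding R_def by (simp add: lead_coeff_prod)
    then show "coeff P (q - 1) = coeff R (q - 1)"
      using q degR by (simp add: P_def coeff_1)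
    show "degree P \<le> q - 1"
      unfolding P_def by (rule degree_diff_le) (auto simp: degree_monom_le)
    fix z :: 'a assume z: "z \<in> UNIV - {0}"
    \<comment> \<open>Multiplication by \<open>z\<close> permutes the nonzero elements; cancelling
      their nonzero product leaves \<open>z ^ (q - 1) = 1\<close>.\<close>
    then have "(\<Prod>x\<in>UNIV - {0}. z * x) = (\<Prod>x\<in>UNIV - {0}. x)"
      by (intro prod.reindex_bij_witness[where i = "\<lambda>x. x / z" and j = "\<lambda>x. z * x"]) auto
    then have "z ^ (q - 1) = 1"
      by (simp add: prod.distrib card)
    moreover have "poly R z = 0"
      using z by (auto simp: R_def poly_prod)
    ultimately show "poly P z = poly R z"
      by (simp add: P_def poly_monom)
  qed (use degR card in auto)
  moreover have "poly P 0 = -1"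
    using q by (simp add: P_def poly_monom)
  ultimately have "(\<Prod>\<alpha>\<in>UNIV - {0::'a}. -\<alpha>) = -1"
    by (simp add: R_def poly_prod)
  moreover have "(\<Prod>\<alpha>\<in>UNIV - {x}. x - \<alpha>) = (\<Prod>\<alpha>\<in>UNIV - {0::'a}. -\<alpha>)"
    by (rule prod.reindex_bij_witness[where i = "\<lambda>\<beta>. \<beta> + x" and j = "\<lambda>\<alpha>. \<alpha> - x"]) auto
  ultimately show ?thesis by simp
qed

section \<open>Polynomial maps of bounded degree\<close>

text \<open>Working with induced maps and an upper bound \<open>d\<close>, rather than with
  polynomials and exact degrees, gives classes whose bounds simply add under multiplication.\<close>

definition poly_maps :: "nat \<Rightarrow> nat \<Rightarrow> ((nat \<Rightarrow> 'a::field) \<Rightarrow> 'a) set"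
  where "poly_maps n d = mv_eval ` {h \<in> mv_polynomials n. total_degree h \<le> d}"

lemma total_degree_le_iff:
  "total_degree h \<le> d \<longleftrightarrow>
    (\<forall>m\<in>Poly_Mapping.keys h. (\<Sum>i\<in>Poly_Mapping.keys m. Poly_Mapping.lookup m i) \<le> d)"
  unfolding total_degree_def by (subst Max_le_iff) auto

text \<open>Coefficients outside the support vanish, so several polynomials can be evaluated over
  one common set of monomials.\<close>

lemma mv_eval_superset:
  assumes "finite M" "Poly_Mapping.keys h \<subseteq> M"
  shows "mv_eval h x =
    (\<Sum>m\<in>M. Poly_Mapping.lookup h m * (\<Prod>i\<in>Poly_Mapping.keys m. x i ^ Poly_Mapping.lookup m i))"
  unfolding mv_eval_def
  using assms by (intro sum.mono_neutral_left) (auto simp: in_keys_iff)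

lemma mv_eval_add: "mv_eval (h + k) x = mv_eval h x + mv_eval k x"
proof -
  \<comment> \<open>Terms may cancel in \<open>h + k\<close>, so its support can be smaller than
    this union; all three evaluations are taken over the union.\<close>
  let ?M = "Poly_Mapping.keys h \<union> Poly_Mapping.keys k"
  have "finite ?M" "Poly_Mapping.keys (h + k) \<subseteq> ?M"
    by (auto simp: keys_add)
  then show ?thesis
    by (simp add: mv_eval_superset[where M = ?M] lookup_add distrib_right sum.distrib
        del: Un_iff)
qed

lemma poly_maps_add:
  assumes "F \<in> poly_maps n d" "H \<in> poly_maps n d"
  shows "(\<lambda>x. F x + H x) \<in> poly_maps n d"
proof -
  from assms obtain h k where
    h: "h \<in> mv_polynomials n" "total_degree h \<le> d" "F = mv_eval h" and
    k: "k \<in> mv_polynomials n" "total_degree k \<le> d" "H = mv_eval k"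
    unfolding poly_maps_def by auto
  have "h + k \<in> mv_polynomials n" "total_degree (h + k) \<le> d"
    using h k keys_add[of h k] unfolding mv_polynomials_def total_degree_le_iff
    by blast+
  moreover have "(\<lambda>x. F x + H x) = mv_eval (h + k)"
    using h k by (simp add: mv_eval_add fun_eq_iff)
  ultimately show ?thesis
    unfolding poly_maps_def by blast
qed

lemma poly_maps_monomial:
  assumes "Poly_Mapping.keys m \<subseteq> {1..n}"
    and "(\<Sum>i\<in>Poly_Mapping.keys m. Poly_Mapping.lookup m i) \<le> d"
  shows "(\<lambda>x. c * (\<Prod>i\<in>Poly_Mapping.keys m. x i ^ Poly_Mapping.lookup m i)) \<in> poly_maps n d"
proof -
  let ?h = "Poly_Mapping.single m c"
  have "?h \<in> mv_polynomials n" "total_degree ?h \<le> d"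
    using assms by (auto simp: mv_polynomials_def total_degree_le_iff)
  moreover have "(\<lambda>x. c * (\<Prod>i\<in>Poly_Mapping.keys m. x i ^ Poly_Mapping.lookup m i)) = mv_eval ?h"
    by (auto simp: mv_eval_def fun_eq_iff)
  ultimately show ?thesis
    unfolding poly_maps_def by blast
qed

lemma poly_maps_const: "(\<lambda>x. c) \<in> poly_maps n d"
  using poly_maps_monomial[of 0 n d c] by simp

lemma poly_maps_coord: "i \<in> {1..n} \<Longrightarrow> d \<ge> 1 \<Longrightarrow> (\<lambda>x. x i) \<in> poly_maps n d"
  using poly_maps_monomial[of "Poly_Mapping.single i 1" n d 1] by simp

lemma poly_maps_sum:
  assumes "\<And>i. i \<in> I \<Longrightarrow> F i \<in> poly_maps n d"
  shows "(\<lambda>x. \<Sum>i\<in>I. F i x) \<in> poly_maps n d"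
  using assms
  by (induction I rule: infinite_finite_induct) (auto intro: poly_maps_const poly_maps_add)

text \<open>The product of two evaluations expands into a double sum of products of monomials. Each
  of these is one monomial with exponent \<open>m + m'\<close>, so no product of polynomials has to
  be formed.\<close>

lemma poly_maps_mult:
  fixes F H :: "(nat \<Rightarrow> 'a::field) \<Rightarrow> 'a"
  assumes "F \<in> poly_maps n d" "H \<in> poly_maps n e"
  shows "(\<lambda>x. F x * H x) \<in> poly_maps n (d + e)"
proof -
  let ?mono = "\<lambda>m x. \<Prod>i\<in>Poly_Mapping.keys m. x i ^ Poly_Mapping.lookup m i :: 'a"
  from assms obtain h k where
    h: "h \<in> mv_polynomials n" "total_degree h \<le> d" "F = mv_eval h" and
    k: "k \<in> mv_polynomials n" "total_degree k \<le> e" "H = mv_eval k"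
    unfolding poly_maps_def by auto
  have "(\<lambda>x. c * ?mono m x * (c' * ?mono m' x)) \<in> poly_maps n (d + e)"
    if m: "m \<in> Poly_Mapping.keys h" "m' \<in> Poly_Mapping.keys k" for c c' m m'
  proof -
    let ?K = "Poly_Mapping.keys m \<union> Poly_Mapping.keys m'"
    have K: "Poly_Mapping.keys (m + m') \<subseteq> ?K" by (rule keys_add)
    \<comment> \<open>Over the common index set \<open>?K\<close>, a variable with exponent 0
      contributes the factor 1 and the summand 0.\<close>
    have mono: "?mono p x = (\<Prod>i\<in>?K. x i ^ Poly_Mapping.lookup p i)"
      and deg: "(\<Sum>i\<in>Poly_Mapping.keys p. Poly_Mapping.lookup p i)
        = (\<Sum>i\<in>?K. Poly_Mapping.lookup p i)"
      if "Poly_Mapping.keys p \<subseteq> ?K" for p x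
      using that
      by (auto intro!: prod.mono_neutral_left sum.mono_neutral_left simp: in_keys_iff)
    have "(\<lambda>x. (c * c') * ?mono (m + m') x) \<in> poly_maps n (d + e)"
    proof (rule poly_maps_monomial)
      show "Poly_Mapping.keys (m + m') \<subseteq> {1..n}"
        using K h(1) k(1) m unfolding mv_polynomials_def by blast
      have "(\<Sum>i\<in>?K. Poly_Mapping.lookup m i) \<le> d" "(\<Sum>i\<in>?K. Poly_Mapping.lookup m' i) \<le> e"
        using h(2) k(2) m deg[of m] deg[of m'] by (auto simp: total_degree_le_iff)
      then show "(\<Sum>i\<in>Poly_Mapping.keys (m + m'). Poly_Mapping.lookup (m + m') i) \<le> d + e"
        unfolding deg[OF K] by (simp add: lookup_add sum.distrib)
    qed
    also have "(\<lambda>x. (c * c') * ?mono (m + m') x) = (\<lambda>x. c * ?mono m x * (c' * ?mono m' x))"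
      unfolding mono[OF K] mono[of m, OF Un_upper1] mono[of m', OF Un_upper2]
      by (simp add: lookup_add power_add prod.distrib mult_ac)
    finally show ?thesis .
  qed
  then show ?thesis
    unfolding h(3) k(3) mv_eval_def sum_product by (intro poly_maps_sum)
qed

lemma poly_maps_prod:
  assumes "\<And>i. i \<in> I \<Longrightarrow> F i \<in> poly_maps n d"
  shows "(\<lambda>x. \<Prod>i\<in>I. F i x) \<in> poly_maps n (card I * d)"
  using assms
proof (induction I rule: infinite_finite_induct)
  case (insert i I)
  then show ?case
    using poly_maps_mult[of "F i" n d "\<lambda>x. \<Prod>i\<in>I. F i x" "card I * d"] by simp
qed (auto intro: poly_maps_const)

text \<open>The degree is a least value, so any one polynomial that represents \<open>f\<close> on
  \<open>W\<close> bounds it.\<close>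

lemma fun_degree_le:
  assumes "P \<in> poly_maps n d" "\<And>w. w \<in> W \<Longrightarrow> f w = P (\<lambda>i. y i w)"
  shows "fun_degree W n y f \<le> d"
proof -
  from assms(1) obtain h where
    h: "h \<in> mv_polynomials n" "total_degree h \<le> d" "P = mv_eval h"
    unfolding poly_maps_def by auto
  with assms(2) have "fun_degree W n y f \<le> total_degree h"
    unfolding fun_degree_def by (intro Least_le) auto
  with h(2) show ?thesis by simp
qed

section \<open>Functions on a subset\<close>

text \<open>Later places the invariants inside \<open>W \<rightarrow>\<^sub>E UNIV\<close>, which
  makes them finite in number.\<close>

lemma poly_functions_extensional: "f \<in> poly_functions W n y \<Longrightarrow> f \<in> extensional W"
  by (induction rule: poly_functions.induct) (simp_all only: restrict_extensional)

text \<open>The introduction rule adds restricted functions; here the inner restrictions are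
  removed, so that sums can be built pointwise.\<close>

lemma poly_functions_add:
  assumes "(\<lambda>w\<in>W. f w) \<in> poly_functions W n y" "(\<lambda>w\<in>W. g w) \<in> poly_functions W n y"
  shows "(\<lambda>w\<in>W. f w + g w) \<in> poly_functions W n y"
  using poly_functions.add[OF assms] by (simp cong: restrict_cong)

lemma poly_functions_mult:
  assumes "(\<lambda>w\<in>W. f w) \<in> poly_functions W n y" "(\<lambda>w\<in>W. g w) \<in> poly_functions W n y"
  shows "(\<lambda>w\<in>W. f w * g w) \<in> poly_functions W n y"
  using poly_functions.mult[OF assms] by (simp cong: restrict_cong)

lemma poly_functions_sum:
  assumes "\<And>i. i \<in> I \<Longrightarrow> (\<lambda>w\<in>W. f i w) \<in> poly_functions W n y"
  shows "(\<lambda>w\<in>W. \<Sum>i\<in>I. f i w) \<in> poly_functions W n y"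
  using assms
  by (induction I rule: infinite_finite_induct)
    (auto intro: poly_functions.const poly_functions_add)

lemma poly_functions_prod:
  assumes "\<And>i. i \<in> I \<Longrightarrow> (\<lambda>w\<in>W. f i w) \<in> poly_functions W n y"
  shows "(\<lambda>w\<in>W. \<Prod>i\<in>I. f i w) \<in> poly_functions W n y"
  using assms
  by (induction I rule: infinite_finite_induct)
    (auto intro: poly_functions.const poly_functions_mult)

section \<open>Point functions and orbit functions\<close>

lemma point_fun_in_poly_functions: "point_fun W n y w \<in> poly_functions W n y"
proof -
  have "(\<lambda>v\<in>W. y i v - \<alpha>) \<in> poly_functions W n y" if "i \<in> {1..n}" for i \<alpha>
    using poly_functions_add[OF poly_functions.coord[OF that] poly_functions.const[where c = "- \<alpha>"]]
    by simp
  then show ?thesis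
    unfolding point_fun_def
    by (intro poly_functions_mult poly_functions.const poly_functions_prod)
qed

lemma orbit_fun_in_poly_functions: "orbit_fun W n y U \<in> poly_functions W n y"
  unfolding orbit_fun_def
proof (rule poly_functions_sum)
  fix u
  have "restrict (point_fun W n y u) W = point_fun W n y u"
    by (simp add: point_fun_def)
  then show "(\<lambda>w\<in>W. point_fun W n y u w) \<in> poly_functions W n y"
    using point_fun_in_poly_functions by (metis eta_contract_eq)
qed

text \<open>At \<open>w\<close> each of the \<open>n\<close> inner products is -1, which the sign
  \<open>(- 1) ^ n\<close> compensates. At another point some coordinate \<open>i\<close> differs,
  and the factor with \<alpha> equal to \<open>y i v\<close> vanishes.\<close>

lemma point_fun_eq:
  assumes inj: "inj_on (\<lambda>v. \<lambda>i\<in>{1..n}. y i v) W" and "w \<in> W" "v \<in> W"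
  shows "point_fun W n y w v = (if v = w then 1 else 0)"
proof (cases "v = w")
  case True
  then show ?thesis
    using assms
    by (simp add: point_fun_def prod_diff_other_elements flip: power_mult_distrib)
next
  case False
  have "\<exists>i\<in>{1..n}. y i v \<noteq> y i w"
  proof (rule ccontr)
    assume "\<not> ?thesis"
    then have "(\<lambda>i\<in>{1..n}. y i v) = (\<lambda>i\<in>{1..n}. y i w)" by (intro restrict_ext) auto
    with False show False using inj_onD[OF inj] assms(2,3) by blast
  qed
  then have "(\<Prod>i = 1..n. \<Prod>\<alpha> \<in> UNIV - {y i w}. y i v - \<alpha>) = 0"
    by (force intro: prod_zero)
  with False assms show ?thesis
    by (simp add: point_fun_def)
qed

lemma orbit_fun_eq:
  assumes "inj_on (\<lambda>v. \<lambda>i\<in>{1..n}. y i v) W" and "finite W" "U \<subseteq> W" "v \<in> W"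
  shows "orbit_fun W n y U v = (if v \<in> U then 1 else 0)"
proof -
  have "orbit_fun W n y U v = (\<Sum>u\<in>U. if v = u then 1 else 0)"
    using assms unfolding orbit_fun_def
    by (auto intro!: sum.cong point_fun_eq)
  also have "\<dots> = (if v \<in> U then 1 else 0)"
    using finite_subset[OF assms(3,2)] by simp
  finally show ?thesis .
qed

text \<open>The defining formula is a constant times \<open>n\<close> blocks of \<open>q - 1\<close>
  linear factors, where \<open>q\<close> is the size of the field.\<close>

lemma point_fun_poly_map:
  fixes y :: "nat \<Rightarrow> 'v \<Rightarrow> 'a::{field,finite}"
  shows "\<exists>P\<in>poly_maps n (n * (card (UNIV :: 'a set) - 1)). \<forall>v\<in>W. point_fun W n y w v = P (\<lambda>i. y i v)"
proof
  let ?P = "\<lambda>x. (- 1) ^ n * (\<Prod>i = 1..n. \<Prod>\<alpha> \<in> UNIV - {y i w}. x i - \<alpha>)"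
  show "\<forall>v\<in>W. point_fun W n y w v = ?P (\<lambda>i. y i v)"
    by (simp add: point_fun_def)
  have "(\<lambda>x. x i - \<alpha>) \<in> poly_maps n 1" if "i \<in> {1..n}" for i and \<alpha> :: 'a
    using poly_maps_add[OF poly_maps_coord[OF that] poly_maps_const[of "- \<alpha>"], of 1] by simp
  then have "(\<lambda>x. \<Prod>\<alpha> \<in> UNIV - {y i w}. x i - \<alpha>) \<in> poly_maps n (card (UNIV :: 'a set) - 1)"
    if "i \<in> {1..n}" for i
    using poly_maps_prod[of "UNIV - {y i w}" "\<lambda>\<alpha> x. x i - \<alpha>" n 1] that
    by (simp add: card_Diff_singleton)
  then have "(\<lambda>x. \<Prod>i = 1..n. \<Prod>\<alpha> \<in> UNIV - {y i w}. x i - \<alpha>)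
      \<in> poly_maps n (n * (card (UNIV :: 'a set) - 1))"
    using poly_maps_prod[of "{1..n}" "\<lambda>i x. \<Prod>\<alpha> \<in> UNIV - {y i w}. x i - \<alpha>"] by simp
  then show "?P \<in> poly_maps n (n * (card (UNIV :: 'a set) - 1))"
    using poly_maps_mult[OF poly_maps_const[of "(- 1) ^ n" n 0]] by simp
qed

lemma fun_degree_orbit_fun_combination:
  fixes y :: "nat \<Rightarrow> 'v \<Rightarrow> 'a::{field,finite}"
  shows "fun_degree W n y (\<lambda>v\<in>W. \<Sum>j\<in>J. c j * orbit_fun W n y (U j) v)
    \<le> n * (card (UNIV :: 'a set) - 1)"
proof -
  obtain P where P: "\<And>w. P w \<in> poly_maps n (n * (card (UNIV :: 'a set) - 1))"
    "\<And>w v. v \<in> W \<Longrightarrow> point_fun W n y w v = P w (\<lambda>i. y i v)"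
    using point_fun_poly_map[of n W y] by metis
  \<comment> \<open>The summand 0 is the degree bound of the scalars \<open>c j\<close>, in the
    shape that \<open>poly_maps_mult\<close> expects.\<close>
  have "(\<lambda>x. \<Sum>j\<in>J. c j * (\<Sum>u\<in>U j. P u x)) \<in> poly_maps n (0 + n * (card (UNIV :: 'a set) - 1))"
    by (intro poly_maps_sum poly_maps_mult poly_maps_const) (rule P(1))
  then show ?thesis
    by (intro fun_degree_le) (auto simp: orbit_fun_def P)
qed

section \<open>Separating sets\<close>

text \<open>Turns a counting bound into a bound on the rounded logarithm: an integer above the real
  logarithm is also above its ceiling.\<close>

lemma gamma_le:
  assumes "q \<ge> 2" "k \<ge> 1" "k \<le> q ^ m"
  shows "gamma q k \<le> m"
proof -
  have "real k \<le> real q ^ m"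
    using assms(3) by (metis of_nat_le_iff of_nat_power)
  then have "log (real q) (real k) \<le> real m"
    using assms by (intro log_of_power_le) auto
  then show ?thesis
    unfolding gamma_def by linarith
qed

text \<open>The values of all functions in \<open>S\<close> at \<open>r i\<close> determine
  \<open>i\<close>, and the right-hand side counts the possible families of values.\<close>

lemma card_le_power_card_separating_set:
  fixes S :: "('v \<Rightarrow> 'a::finite) set"
  assumes S: "separating_set A W S" "finite S"
    and r: "\<And>i. i \<in> I \<Longrightarrow> r i \<in> W"
    and sep: "\<And>i j. i \<in> I \<Longrightarrow> j \<in> I \<Longrightarrow> i \<noteq> j \<Longrightarrow> separated_by A (r i) (r j)"
  shows "card I \<le> card (UNIV :: 'a set) ^ card S"
proof -
  let ?e = "\<lambda>i. \<lambda>f\<in>S. f (r i)"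
  have "inj_on ?e I"
  proof (rule inj_onI, rule ccontr)
    fix i j assume ij: "i \<in> I" "j \<in> I" "?e i = ?e j" "i \<noteq> j"
    then obtain f where "f \<in> S" "f (r i) \<noteq> f (r j)"
      using S(1) r sep unfolding separating_set_def separated_by_def by metis
    with ij(3) show False by (metis restrict_apply')
  qed
  then have "card I \<le> card (S \<rightarrow>\<^sub>E (UNIV :: 'a set))"
    using S(2) by (intro card_inj_on_le) (auto simp: finite_PiE)
  then show ?thesis
    using S(2) by (simp add: card_funcsetE)
qed

section \<open>Orbits and coordinates\<close>

text \<open>The point that needs an argument is the linearity of the inverse map.\<close>

lemma group_GL:
  fixes scale :: "'a::field \<Rightarrow> 'v::ab_group_add \<Rightarrow> 'v"
  assumes "vector_space scale"
  shows "group (GL scale)"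
proof (rule groupI)
  fix g assume "g \<in> carrier (GL scale)"
  then have lin: "Vector_Spaces.linear scale scale g" and g: "bij g"
    by (auto simp: GL_def)
  have "Vector_Spaces.linear scale scale (inv_into UNIV g)"
    unfolding Vector_Spaces.linear_iff
  proof (intro conjI allI assms)
    have inv: "inv_into UNIV g (g u) = u" "g (inv_into UNIV g u) = u" for u
      using g by (simp_all add: bij_is_inj bij_is_surj surj_f_inv_f)
    fix x y c
    \<comment> \<open>By linearity \<open>g\<close> sends the sum of the preimages to
      \<open>x + y\<close>; the inverse is then applied to both sides.\<close>
    have "inv_into UNIV g (g (inv_into UNIV g x + inv_into UNIV g y))
        = inv_into UNIV g (x + y)"
      using lin by (simp add: Vector_Spaces.linear_iff inv)
    then show "inv_into UNIV g (x + y) = inv_into UNIV g x + inv_into UNIV g y"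
      by (simp only: inv)
    have "inv_into UNIV g (g (scale c (inv_into UNIV g x))) = inv_into UNIV g (scale c x)"
      using lin by (simp add: Vector_Spaces.linear_iff inv)
    then show "inv_into UNIV g (scale c x) = scale c (inv_into UNIV g x)"
      by (simp only: inv)
  qed
  then have "inv_into UNIV g \<in> carrier (GL scale)"
    "inv_into UNIV g \<otimes>\<^bsub>GL scale\<^esub> g = \<one>\<^bsub>GL scale\<^esub>"
    using g by (auto simp: GL_def bij_imp_bij_inv bij_is_inj)
  then show "\<exists>h\<in>carrier (GL scale). h \<otimes>\<^bsub>GL scale\<^esub> g = \<one>\<^bsub>GL scale\<^esub>" by blast
qed (use assms in \<open>auto simp: GL_def Vector_Spaces.linear_iff bij_comp comp_assoc\<close>)

text \<open>Orbits are equivalence classes: the identity gives reflexivity, composition transitivity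
  and inverses symmetry.\<close>

lemma linear_orbit_partition:
  fixes scale :: "'a::field \<Rightarrow> 'v::ab_group_add \<Rightarrow> 'v"
  assumes "vector_space scale" "subgroup G (GL scale)"
  defines "orb \<equiv> orbit (GL scale\<lparr>carrier := G\<rparr>) (\<lambda>g. g)"
  shows "w \<in> orb w"
    and "u \<in> orb w \<Longrightarrow> orb u = orb w"
    and "g \<in> G \<Longrightarrow> g w \<in> orb w"
proof -
  interpret GL: group "GL scale" by (rule group_GL) fact
  interpret subgroup G "GL scale" by fact
  have orb: "orb w = (\<lambda>g. g w) ` G" for w
    by (auto simp: orb_def orbit_def)
  show "g \<in> G \<Longrightarrow> g w \<in> orb w" by (simp add: orb)
  have "id \<in> G" using one_closed by (simp add: GL_def)
  then show "w \<in> orb w" unfolding orb by (metis id_apply imageI)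
  have comp: "g \<circ> h \<in> G" if "g \<in> G" "h \<in> G" for g h
    using m_closed[OF that] by (simp add: GL_def)
  have sub: "orb u \<subseteq> orb w" if "u \<in> orb w" for u w
  proof
    fix v assume "v \<in> orb u"
    with that obtain g h where gh: "g \<in> G" "h \<in> G" "v = g (h w)" unfolding orb by blast
    then have "v = (g \<circ> h) w" by simp
    with comp[OF gh(1,2)] show "v \<in> orb w" unfolding orb by blast
  qed
  have sym: "w \<in> orb u" if u: "u \<in> orb w" for u w
  proof -
    from u obtain g where g: "g \<in> G" "u = g w" unfolding orb by blast
    \<comment> \<open>Closure under inverses refers to the abstract inverse in
      \<open>GL scale\<close>; this identifies it as a left inverse of the map
      \<open>g\<close>.\<close>
    have "inv\<^bsub>GL scale\<^esub> g \<circ> g = id"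
      using GL.l_inv[OF mem_carrier[OF g(1)]] by (simp add: GL_def)
    then have "w = (inv\<^bsub>GL scale\<^esub> g) u" using g(2) by (metis comp_apply id_apply)
    then show ?thesis using m_inv_closed[OF g(1)] unfolding orb by blast
  qed
  show "orb u = orb w" if "u \<in> orb w"
    using sub sym that by blast
qed

text \<open>A vector is the sum of the basis vectors weighted by its coordinates. Injectivity makes
  point functions indicators and embeds the space into a finite set.\<close>

lemma inj_coordinates:
  fixes scale :: "'a::field \<Rightarrow> 'v::ab_group_add \<Rightarrow> 'v"
  assumes "finite_dimensional_vector_space scale (b ` {1..n})"
  shows "inj (\<lambda>v. \<lambda>i\<in>{1..n}. coord scale n b i v)"
proof (rule injI)
  interpret finite_dimensional_vector_space scale "b ` {1..n}" by fact
  fix u v assume eq: "(\<lambda>i\<in>{1..n}. coord scale n b i u) = (\<lambda>i\<in>{1..n}. coord scale n b i v)"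
  have "representation (b ` {1..n}) u a = representation (b ` {1..n}) v a"
    if a: "a \<in> b ` {1..n}" for a
  proof -
    from a obtain i where "i \<in> {1..n}" "a = b i" by blast
    then show ?thesis using fun_cong[OF eq, of i] by (simp add: coord_def)
  qed
  moreover have "(\<Sum>a\<in>b ` {1..n}. scale (representation (b ` {1..n}) w a) a) = w" for w
    using independent_Basis span_Basis by (intro sum_representation_eq) auto
  ultimately show "u = v" by (metis (no_types, lifting) sum.cong)
qed

theorem theorem2p1:
  fixes scale :: "'a::{field,finite} \<Rightarrow> 'v::ab_group_add \<Rightarrow> 'v"
    and n :: nat and b :: "nat \<Rightarrow> 'v"
    and G :: "('v \<Rightarrow> 'v) set" and W :: "'v set" and U :: "nat \<Rightarrow> 'v set"
    and q \<kappa> \<gamma> :: nat and y :: "nat \<Rightarrow> 'v \<Rightarrow> 'a"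
    and A :: "('v \<Rightarrow> 'a) set" and f :: "nat \<Rightarrow> 'v \<Rightarrow> 'a"
  assumes basis: "finite_dimensional_vector_space scale (b ` {1..n})" "inj_on b {1..n}"
    and G: "subgroup G (GL scale)"
    and W: "W \<noteq> {}" "\<And>g w. g \<in> G \<Longrightarrow> w \<in> W \<Longrightarrow> g w \<in> W"
  defines "q \<equiv> card (UNIV :: 'a set)"
    and "\<kappa> \<equiv> card (orbits (GL scale\<lparr>carrier := G\<rparr>) W (\<lambda>g. g))"
    and "\<gamma> \<equiv> gamma q \<kappa>"
    and "y \<equiv> coord scale n b"
    and "A \<equiv> invariant_poly_functions G W n y"
    and "f \<equiv> \<lambda>j. orbit_fun W n y (U j)"
  assumes U: "bij_betw U {1..\<kappa>} (orbits (GL scale\<lparr>carrier := G\<rparr>) W (\<lambda>g. g))"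
  shows "(\<forall>S. separating_set A W S \<longrightarrow> card S \<ge> \<gamma>) \<and>
    (\<forall>\<alpha> :: nat \<Rightarrow> nat \<Rightarrow> 'a.
       (\<forall>j\<in>{1..\<kappa>}. \<forall>k\<in>{1..\<kappa>}. j \<noteq> k \<longrightarrow> (\<exists>i\<in>{1..\<gamma>}. \<alpha> i j \<noteq> \<alpha> i k)) \<longrightarrow>
       (let h = (\<lambda>i. \<lambda>v\<in>W. \<Sum>j = 1..\<kappa>. \<alpha> i j * f j v) in
          minimal_separating_set A W (h ` {1..\<gamma>}) \<and>
          (\<forall>i\<in>{1..\<gamma>}. fun_degree W n y (h i) \<le> n * (q - 1))))"
proof -
  interpret finite_dimensional_vector_space scale "b ` {1..n}" by (fact basis(1))
  define orb where "orb = orbit (GL scale\<lparr>carrier := G\<rparr>) (\<lambda>g. g)"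
  define orbs where "orbs = orbits (GL scale\<lparr>carrier := G\<rparr>) W (\<lambda>g. g)"
  note orb = linear_orbit_partition[OF vector_space_axioms G, folded orb_def]
  have orbs: "orbs = orb ` W"
    by (auto simp: orbs_def orbits_def orb_def)
  have orb_sub: "orb w \<subseteq> W" if "w \<in> W" for w
    using W(2) that by (auto simp: orb_def orbit_def)

  \<comment> \<open>Finiteness of the space and of the set of invariants\<close>
  have inj: "inj (\<lambda>v. \<lambda>i\<in>{1..n}. y i v)"
    unfolding y_def by (rule inj_coordinates) (fact basis(1))
  then have injW: "inj_on (\<lambda>v. \<lambda>i\<in>{1..n}. y i v) W"
    by (rule inj_on_subset) simp
  have "finite ({1..n} \<rightarrow>\<^sub>E (UNIV :: 'a set))"
    by (intro finite_PiE) auto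
  moreover have "range (\<lambda>v. \<lambda>i\<in>{1..n}. y i v) \<subseteq> {1..n} \<rightarrow>\<^sub>E UNIV"
    by auto
  ultimately have "finite (UNIV :: 'v set)"
    using inj by (metis finite_imageD finite_subset)
  then have finW: "finite W"
    by (rule finite_subset[OF subset_UNIV])
  have "A \<subseteq> W \<rightarrow>\<^sub>E UNIV"
    by (auto simp: A_def invariant_poly_functions_def dest: poly_functions_extensional
        intro: PiE_I extensional_arb)
  then have finA: "finite A"
    using finW by (metis finite finite_PiE finite_subset)

  \<comment> \<open>Since \<open>card\<close> is 0 on infinite sets as well as on the empty set,
    both finiteness and nonemptiness of \<open>W\<close> enter.\<close>
  have \<kappa>: "\<kappa> \<ge> 1"
    using W(1) finW by (simp add: \<kappa>_def flip: orbs_def) (simp add: orbs Suc_le_eq card_gt_0_iff)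
  have "card {0, 1::'a} \<le> q"
    unfolding q_def by (rule card_mono) auto
  then have q: "q \<ge> 2" by simp

  \<comment> \<open>The enumerated orbits \<open>U j\<close> as a partition of
    \<open>W\<close>\<close>
  have Ub: "bij_betw U {1..\<kappa>} orbs"
    using U by (simp only: orbs_def)
  have U_in: "U j \<in> orbs" if "j \<in> {1..\<kappa>}" for j
    using bij_betw_apply[OF Ub that] .
  have U_orb: "U j = orb v" if "j \<in> {1..\<kappa>}" "v \<in> U j" for j v
  proof -
    from U_in[OF that(1)] obtain w where "w \<in> W" "U j = orb w"
      by (auto simp: orbs)
    with that(2) orb(2) show ?thesis by simp
  qed
  have U_ex: "\<exists>j\<in>{1..\<kappa>}. v \<in> U j" if "v \<in> W" for v
  proof -
    have "orb v \<in> U ` {1..\<kappa>}"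
      using bij_betw_imp_surj_on[OF Ub] that by (simp add: orbs)
    with orb(1)[of v] show ?thesis by auto
  qed
  have U_sub: "U j \<subseteq> W" and U_ne: "U j \<noteq> {}" if "j \<in> {1..\<kappa>}" for j
  proof -
    from U_in[OF that] obtain w where "w \<in> W" "U j = orb w"
      by (auto simp: orbs)
    with orb(1)[of w] orb_sub[of w] show "U j \<subseteq> W" "U j \<noteq> {}" by auto
  qed
  have U_unique: "j = k" if "j \<in> {1..\<kappa>}" "k \<in> {1..\<kappa>}" "v \<in> U j" "v \<in> U k" for j k v
    using bij_betw_imp_inj_on[OF Ub] that U_orb by (metis inj_onD)

  have f_eq: "f j v = (if v \<in> U j then 1 else 0)" if "j \<in> {1..\<kappa>}" "v \<in> W" for j v
    unfolding f_def using injW finW U_sub that by (intro orbit_fun_eq) auto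
  have G_U: "g v \<in> U j \<longleftrightarrow> v \<in> U j" if "g \<in> G" "j \<in> {1..\<kappa>}" for g v j
    using that U_orb orb by metis
  \<comment> \<open>Arbitrary coefficients cover two cases at once: the functions \<open>h i\<close>
    and the indicators that separate orbits.\<close>
  have comb_in_A: "(\<lambda>v\<in>W. \<Sum>j = 1..\<kappa>. c j * f j v) \<in> A" for c
    unfolding A_def invariant_poly_functions_def
  proof (intro CollectI conjI ballI)
    have "(\<lambda>v\<in>W. f j v) = f j" for j
      by (simp add: f_def orbit_fun_def cong: restrict_cong)
    then show "(\<lambda>v\<in>W. \<Sum>j = 1..\<kappa>. c j * f j v) \<in> poly_functions W n y"
      by (intro poly_functions_sum poly_functions_mult poly_functions.const)
        (simp add: f_def orbit_fun_in_poly_functions)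
    fix g w assume "g \<in> G" "w \<in> W"
    then show "(\<lambda>v\<in>W. \<Sum>j = 1..\<kappa>. c j * f j v) (g w) = (\<lambda>v\<in>W. \<Sum>j = 1..\<kappa>. c j * f j v) w"
      using W(2) by (auto intro!: sum.cong simp: f_eq G_U)
  qed
  have comb_eq: "(\<lambda>v\<in>W. \<Sum>j = 1..\<kappa>. c j * f j v) v = c k"
    if k: "k \<in> {1..\<kappa>}" "v \<in> U k" for c k v
  proof -
    have v: "v \<in> W" using U_sub k by blast
    have "(\<Sum>j = 1..\<kappa>. c j * f j v) = (\<Sum>j = 1..\<kappa>. if j = k then c j else 0)"
      using U_unique k v by (intro sum.cong) (auto simp: f_eq)
    with k v show ?thesis by simp
  qed

  \<comment> \<open>Lower bound from orbit representatives\<close>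
  define r where "r j = (SOME v. v \<in> U j)" for j
  have r: "r j \<in> U j" if "j \<in> {1..\<kappa>}" for j
    using U_ne[OF that] by (simp add: r_def some_in_eq)
  have "separated_by A (r j) (r k)" if "j \<in> {1..\<kappa>}" "k \<in> {1..\<kappa>}" "j \<noteq> k" for j k
  proof -
    \<comment> \<open>The indicator of \<open>U j\<close>, written as a combination so that
      \<open>comb_eq\<close> and \<open>comb_in_A\<close> apply to it.\<close>
    let ?g = "\<lambda>v\<in>W. \<Sum>l = 1..\<kappa>. (if l = j then 1 else 0) * f l v"
    have "?g (r j) = (if j = j then 1 else 0)"
      using that(1) r[OF that(1)] by (rule comb_eq)
    moreover have "?g (r k) = (if k = j then 1 else 0)"
      using that(2) r[OF that(2)] by (rule comb_eq)
    ultimately have "?g (r j) \<noteq> ?g (r k)" using that(3) by simp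
    then show ?thesis
      unfolding separated_by_def using comb_in_A by (rule bexI)
  qed
  then have lower: "\<gamma> \<le> card S" if S: "separating_set A W S" for S
  proof -
    \<comment> \<open>An infinite \<open>S\<close> would have \<open>card\<close> 0; finiteness of
      \<open>A\<close> rules this out.\<close>
    have "finite S" using S finA finite_subset unfolding separating_set_def by blast
    with S have "card {1..\<kappa>} \<le> card (UNIV :: 'a set) ^ card S"
      by (rule card_le_power_card_separating_set[where r = r]) (use U_sub r in blast, fact)
    then show ?thesis
      unfolding \<gamma>_def using q \<kappa> by (intro gamma_le) (auto simp: q_def)
  qed

  \<comment> \<open>Separation and minimality of the functions \<open>h i\<close>\<close>
  have A_const: "a u = a v" if a: "a \<in> A" "j \<in> {1..\<kappa>}" "u \<in> U j" "v \<in> U j" for a j u v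
  proof -
    have "u \<in> orb v" "v \<in> W" using U_orb U_sub that by blast+
    then show ?thesis
      using a(1) by (auto simp: orb_def orbit_def A_def invariant_poly_functions_def)
  qed
  have min: "minimal_separating_set A W (h ` {1..\<gamma>})"
    if cols: "\<forall>j\<in>{1..\<kappa>}. \<forall>k\<in>{1..\<kappa>}. j \<noteq> k \<longrightarrow> (\<exists>i\<in>{1..\<gamma>}. \<alpha> i j \<noteq> \<alpha> i k)"
      and h: "h = (\<lambda>i. \<lambda>v\<in>W. \<Sum>j = 1..\<kappa>. \<alpha> i j * f j v)" for \<alpha> h
    unfolding minimal_separating_set_def
  proof (intro conjI allI impI notI)
    show "separating_set A W (h ` {1..\<gamma>})"
      unfolding separating_set_def
    proof (intro conjI ballI impI)
      show "h ` {1..\<gamma>} \<subseteq> A" unfolding h using comb_in_A by blast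
      fix u v assume uv: "u \<in> W" "v \<in> W" "separated_by A u v"
      from uv U_ex obtain j k where
        jk: "j \<in> {1..\<kappa>}" "u \<in> U j" "k \<in> {1..\<kappa>}" "v \<in> U k" by blast
      \<comment> \<open>Invariants are constant on an orbit, so separated points lie in different
        orbits and hence belong to different columns.\<close>
      with uv(3) A_const have "j \<noteq> k" unfolding separated_by_def by blast
      with cols jk obtain i where i: "i \<in> {1..\<gamma>}" "\<alpha> i j \<noteq> \<alpha> i k" by blast
      moreover have "h i u = \<alpha> i j" "h i v = \<alpha> i k"
        unfolding h using jk by (simp_all only: comb_eq)
      ultimately show "separated_by (h ` {1..\<gamma>}) u v"
        unfolding separated_by_def by (intro bexI[where x = "h i"]) auto
    qed
    fix T assume T: "T \<subset> h ` {1..\<gamma>}" "separating_set A W T"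
    have "card T < card (h ` {1..\<gamma>})"
      using T(1) by (intro psubset_card_mono) auto
    \<comment> \<open>An upper bound suffices here, whether or not the \<open>h i\<close> are
      distinct: \<open>T\<close> then has fewer than \<gamma> elements, against the lower
      bound.\<close>
    also have "\<dots> \<le> \<gamma>"
      using card_image_le[of "{1..\<gamma>}" h] by simp
    finally show False using lower[OF T(2)] by simp
  qed
  have deg: "fun_degree W n y (\<lambda>v\<in>W. \<Sum>j = 1..\<kappa>. c j * f j v) \<le> n * (q - 1)" for c
    unfolding f_def q_def by (rule fun_degree_orbit_fun_combination)
  show ?thesis
    unfolding Let_def
  proof (intro conjI allI impI)
    fix S assume "separating_set A W S"
    then show "\<gamma> \<le> card S" by (rule lower)
  next
    fix \<alpha> :: "nat \<Rightarrow> nat \<Rightarrow> 'a"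
    assume "\<forall>j\<in>{1..\<kappa>}. \<forall>k\<in>{1..\<kappa>}. j \<noteq> k \<longrightarrow> (\<exists>i\<in>{1..\<gamma>}. \<alpha> i j \<noteq> \<alpha> i k)"
    then show "minimal_separating_set A W
        ((\<lambda>i. \<lambda>v\<in>W. \<Sum>j = 1..\<kappa>. \<alpha> i j * f j v) ` {1..\<gamma>})"
      by (rule min[OF _ refl])
  qed (intro ballI deg)
qed

end
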